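(* Let $n,k\ge1$ be integers, let $\omega_1,\dots,\omega_k:[0,1]\to\mathbb{R}$ be continuous, linearly independent basis input functions, and let $\mathcal{C}_{1,1}$ be the associated sign system concept class for $n$-dimensional systems with scalar input and scalar output. Then $$\mathrm{VC}(\mathcal{C}_{1,1})\ge\max\left\{m'\left\lfloor\log_2\left\lfloor\frac{k}{m'}\right\rfloor\right\rfloor,\ m'\right\},\qquad\text{where } m'=\min\{n,k\}.$$
   Context: A linear system $\Sigma=(A,B,C,x^0)$ of dimension $n$ with scalar input and output is $\dot x=Ax+Bu$, $x(0)=x^0$, $y=Cx$ on $[0,1]$, with $A,B,C$ real matrices of sizes $n\times n$, $n\times1$, $1\times n$ and $x^0\in\mathbb{R}^n$. Let $X_\Omega=\{\sum_{j=1}^kg_j\omega_j : g\in\mathbb{R}^k\}$. Let $S_\Sigma:X_\Omega\to\{0,1\}$ map a control $u\in X_\Omega$ to $\mathrm{sign}(y(1))$, where $y(1)$ is the final output of $\Sigma$ under control $u$, and $\mathrm{sign}\,z=1$ if $z>0$, $\mathrm{sign}\,z=0$ if $z\le0$. Then $\mathcal{C}_{1,1}=\{S_\Sigma:\Sigma\text{ a linear system of dimension }n\}$. VC-dimension: for a class $\mathcal{C}$ of maps $X\to\{0,1\}$, a set $D\subseteq X$ is shattered if every map $D\to\{0,1\}$ is the restriction to $D$ of some element of $\mathcal{C}$; $\mathrm{VC}(\mathcal{C})$ is the largest cardinality of a shattered set. $\lfloor x\rfloor$ denotes the integer part of $x$. *)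

theory Defs
  imports "HOL-Analysis.Analysis" "HOL-Library.Extended_Nat" "HOL-Library.FuncSet"
begin

section \<open>Shattering and VC-dimension\<close>

text \<open>A concept on \<open>X\<close> is a map \<open>X \<rightarrow> {0, 1}\<close>, represented by a function with values in \<open>nat\<close>.\<close>

definition shattered :: "('a \<Rightarrow> nat) set \<Rightarrow> 'a set \<Rightarrow> bool" where
  "shattered \<C> D \<longleftrightarrow> (\<forall>f \<in> D \<rightarrow>\<^sub>E {0, 1}. \<exists>c\<in>\<C>. restrict c D = f)"

text \<open>
  Subsets of shattered sets are shattered, so the supremum over the finite shattered sets is the
  largest cardinality of a shattered set, and it is \<open>\<infinity>\<close> if there is no such largest cardinality.
\<close>

definition VC :: "'a set \<Rightarrow> ('a \<Rightarrow> nat) set \<Rightarrow> enat" where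
  "VC X \<C> = Sup {enat (card D) | D. D \<subseteq> X \<and> finite D \<and> shattered \<C> D}"

section \<open>Linear systems with scalar input and output\<close>

text \<open>The dimension of the system is \<open>CARD('n)\<close>.\<close>

record ('n::finite) linear_system =
  sysA :: "real ^ 'n ^ 'n"
  sysB :: "real ^ 1 ^ 'n"
  sysC :: "real ^ 'n ^ 1"
  init :: "real ^ 'n"

definition trajectory ::
    "('n::finite) linear_system \<Rightarrow> (real \<Rightarrow> real) \<Rightarrow> (real \<Rightarrow> real ^ 'n) \<Rightarrow> bool" where
  "trajectory \<Sigma> u x \<longleftrightarrow> x 0 = init \<Sigma> \<and>
     (\<forall>t\<in>{0..1}. (x has_vector_derivative (sysA \<Sigma> *v x t + sysB \<Sigma> *v vec (u t)))
        (at t within {0..1}))"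

text \<open>
  For continuous \<open>u\<close> the trajectory exists and is unique on \<open>{0..1}\<close>, so the description below
  denotes \<open>y(1)\<close>.
\<close>

definition final_output :: "('n::finite) linear_system \<Rightarrow> (real \<Rightarrow> real) \<Rightarrow> real" where
  "final_output \<Sigma> u = (THE y. \<exists>x. trajectory \<Sigma> u x \<and> y = (sysC \<Sigma> *v x 1) $ 1)"

section \<open>The sign system concept class\<close>

text \<open>Unlike \<open>sgn\<close>, this function takes only the values 0 and 1.\<close>

definition sign01 :: "real \<Rightarrow> nat" where
  "sign01 z = (if z > 0 then 1 else 0)"

text \<open>Functions on \<open>[0,1]\<close> are represented by their extensional versions.\<close>

definition controls :: "nat \<Rightarrow> (nat \<Rightarrow> real \<Rightarrow> real) \<Rightarrow> (real \<Rightarrow> real) set" where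
  "controls k \<omega> = {\<lambda>t\<in>{0..1}. \<Sum>j=1..k. g j * \<omega> j t | g. True}"

definition lin_indep_inputs :: "nat \<Rightarrow> (nat \<Rightarrow> real \<Rightarrow> real) \<Rightarrow> bool" where
  "lin_indep_inputs k \<omega> \<longleftrightarrow>
     (\<forall>g. (\<forall>t\<in>{0..1}. (\<Sum>j=1..k. g j * \<omega> j t) = 0) \<longrightarrow> (\<forall>j\<in>{1..k}. g j = 0))"

definition sign_concept ::
    "nat \<Rightarrow> (nat \<Rightarrow> real \<Rightarrow> real) \<Rightarrow> ('n::finite) linear_system \<Rightarrow> (real \<Rightarrow> real) \<Rightarrow> nat" where
  "sign_concept k \<omega> \<Sigma> = (\<lambda>u\<in>controls k \<omega>. sign01 (final_output \<Sigma> u))"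

definition sign_class ::
    "'n::finite itself \<Rightarrow> nat \<Rightarrow> (nat \<Rightarrow> real \<Rightarrow> real) \<Rightarrow> ((real \<Rightarrow> real) \<Rightarrow> nat) set" where
  "sign_class _ k \<omega> = {sign_concept k \<omega> \<Sigma> | \<Sigma> :: 'n linear_system. True}"

end

theory Submission
  imports Defs
begin

text \<open>
  The diagonal system with eigenvalues \<open>l i\<close>, all input weights 1, output weights \<open>b i\<close> and initial
  state 0 has the final output \<open>\<Sum>i. b i * L u (l i)\<close>, where
  \<open>L u \<mu> = exp_response u \<mu> = \<integral>\<^sub>0\<^sup>1 exp (\<mu> * (1 - s)) * u s ds\<close>. A continuous \<open>u\<close> with
  \<open>L u = 0\<close> is orthogonal to all polynomials in \<open>exp (- s)\<close>, so it vanishes on \<open>[0,1]\<close> by the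
  Weierstrass approximation theorem (\<open>exp_response_injective\<close>). Therefore the functions \<open>L (\<omega> j)\<close>,
  for \<open>1 \<le> j \<le> k\<close>, are linearly independent. Hence there are \<open>k\<close> real numbers at which the
  functions \<open>L u\<close>, for \<open>u\<close> a control, take arbitrary prescribed values (\<open>interpolation_nodes\<close>).

  Let \<open>I\<close> be a set of coordinates of the state space with \<open>card I * (2 ^ q - 1) \<le> k\<close>. Assign
  distinct nodes \<open>\<mu> (i, S)\<close> to the pairs of \<open>i \<in> I\<close> and a nonempty \<open>S \<subseteq> {..<q}\<close>, and choose
  controls \<open>u (i, p)\<close>, for \<open>i \<in> I\<close> and \<open>p < q\<close>, such that \<open>L (u (i, p)) (\<mu> (j, S))\<close> is 1 if \<open>i = j\<close>
  and \<open>p \<in> S\<close>, and 0 otherwise. To pick out a given set \<open>T\<close> of these controls, let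
  \<open>S\<^sub>i = {p. (i, p) \<in> T}\<close>, place the eigenvalue \<open>l i\<close> at \<open>\<mu> (i, S\<^sub>i)\<close> with weight \<open>b i = 1\<close>, and put
  \<open>b i = 0\<close> if \<open>S\<^sub>i\<close> is empty; the final output is then the indicator function of \<open>T\<close>. So \<open>card I * q\<close>
  controls are shattered (\<open>VC_sign_class_ge\<close>). With \<open>card I = min n k\<close>, the choice \<open>q = 1\<close> gives one
  term of the maximum, and the largest \<open>q\<close> with \<open>card I * 2 ^ q \<le> k\<close> gives the other.
\<close>

section \<open>Final outputs of diagonal systems\<close>

text \<open>
  The convolution of \<open>u\<close> with \<open>\<lambda>t. exp (\<mu> * t)\<close>, evaluated at time 1. Up to the factor \<open>exp \<mu>\<close> it is
  the finite Laplace transform of \<open>u\<close>.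
\<close>

definition exp_response :: "(real \<Rightarrow> real) \<Rightarrow> real \<Rightarrow> real" where
  "exp_response u \<mu> = integral {0..1} (\<lambda>s. exp (\<mu> * (1 - s)) * u s)"

lemma exp_response_cong:
  assumes "\<And>t. t \<in> {0..1} \<Longrightarrow> u t = v t"
  shows "exp_response u \<mu> = exp_response v \<mu>"
  unfolding exp_response_def by (rule integral_cong) (simp add: assms)

lemma exp_response_sum:
  assumes "finite J" and "\<And>j. j \<in> J \<Longrightarrow> continuous_on {0..1} (f j)"
  shows "exp_response (\<lambda>t. \<Sum>j\<in>J. g j * f j t) \<mu> = (\<Sum>j\<in>J. g j * exp_response (f j) \<mu>)"
proof -
  have "integral {0..1} (\<lambda>s. \<Sum>j\<in>J. g j * (exp (\<mu> * (1 - s)) * f j s))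
      = (\<Sum>j\<in>J. integral {0..1} (\<lambda>s. g j * (exp (\<mu> * (1 - s)) * f j s)))"
    by (rule integral_sum) (auto intro!: integrable_continuous_real continuous_intros assms)
  then show ?thesis
    by (simp add: exp_response_def sum_distrib_left mult.left_commute)
qed

lemma scalar_ode_final_value:
  fixes z u :: "real \<Rightarrow> real"
  assumes "z 0 = 0"
    and "\<And>t. t \<in> {0..1} \<Longrightarrow> (z has_vector_derivative \<mu> * z t + u t) (at t within {0..1})"
  shows "z 1 = exp_response u \<mu>"
proof -
  \<comment> \<open>Multiply the equation by the integrating factor \<open>exp (\<mu> * (1 - t))\<close>.\<close>
  have "((\<lambda>t. exp (\<mu> * (1 - t)) * z t) has_vector_derivative exp (\<mu> * (1 - t)) * u t)
      (at t within {0..1})" if "t \<in> {0..1}" for t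
    using assms(2)[OF that]
    unfolding has_real_derivative_iff_has_vector_derivative[symmetric]
    by (auto intro!: derivative_eq_intros simp: algebra_simps)
  then have "((\<lambda>t. exp (\<mu> * (1 - t)) * u t) has_integral
      exp (\<mu> * (1 - 1)) * z 1 - exp (\<mu> * (1 - 0)) * z 0) {0..1}"
    by (intro fundamental_theorem_of_calculus) auto
  then show ?thesis
    using assms(1) by (simp add: exp_response_def integral_unique)
qed

lemma scalar_ode_solution_exists:
  fixes u :: "real \<Rightarrow> real"
  assumes "continuous_on {0..1} u"
  shows "\<exists>z. z 0 = 0 \<and>
    (\<forall>t\<in>{0..1}. (z has_vector_derivative \<mu> * z t + u t) (at t within {0..1}))"
proof -
  let ?z = "\<lambda>t. exp (\<mu> * t) * integral {0..t} (\<lambda>s. exp (- \<mu> * s) * u s)"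
  have "(?z has_vector_derivative \<mu> * ?z t + u t) (at t within {0..1})" if t: "t \<in> {0..1}" for t
  proof -
    have "((\<lambda>t. integral {0..t} (\<lambda>s. exp (- \<mu> * s) * u s)) has_real_derivative
        exp (- \<mu> * t) * u t) (at t within {0..1})"
      unfolding has_real_derivative_iff_has_vector_derivative
      using t by (intro integral_has_vector_derivative continuous_intros assms)
    then show ?thesis
      unfolding has_real_derivative_iff_has_vector_derivative[symmetric]
      by (auto intro!: derivative_eq_intros simp: algebra_simps simp flip: exp_add)
  qed
  then show ?thesis
    by (intro exI[of _ ?z]) simp
qed

text \<open>The system \<open>x\<^sub>i' = l i * x\<^sub>i + u\<close>, \<open>x\<^sub>i(0) = 0\<close>, \<open>y = \<Sum>i. b i * x\<^sub>i\<close>.\<close>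

definition diagonal_system :: "('n::finite \<Rightarrow> real) \<Rightarrow> ('n \<Rightarrow> real) \<Rightarrow> 'n linear_system" where
  "diagonal_system b l = \<lparr>sysA = (\<chi> i j. if i = j then l i else 0), sysB = (\<chi> i j. 1),
     sysC = (\<chi> _ i. b i), init = 0\<rparr>"

text \<open>The state equation decouples into scalar equations.\<close>

lemma trajectory_diagonal_system_iff:
  "trajectory (diagonal_system b l) u x \<longleftrightarrow> (\<forall>i. x 0 $ i = 0 \<and>
     (\<forall>t\<in>{0..1}. ((\<lambda>t. x t $ i) has_vector_derivative l i * x t $ i + u t) (at t within {0..1})))"
proof -
  have field: "sysA (diagonal_system b l) *v y + sysB (diagonal_system b l) *v vec c
      = (\<chi> i. l i * y $ i + c)" for y c
    by (simp add: vec_eq_iff diagonal_system_def matrix_vector_mult_def if_distrib[of "\<lambda>a. a * _"]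
        cong: if_cong)
  have "(x has_vector_derivative (\<chi> i. l i * x t $ i + u t)) (at t within {0..1}) \<longleftrightarrow>
      (\<forall>i. ((\<lambda>t. x t $ i) has_vector_derivative l i * x t $ i + u t) (at t within {0..1}))" for t
    unfolding has_vector_derivative_def has_derivative_componentwise_within[of x]
    by (simp add: Basis_vec_def inner_axis)
  then show ?thesis
    unfolding trajectory_def field
    by (auto simp: diagonal_system_def vec_eq_iff)
qed

lemma final_output_diagonal_system:
  assumes "continuous_on {0..1} u"
  shows "final_output (diagonal_system b l) u = (\<Sum>i\<in>UNIV. b i * exp_response u (l i))"
proof -
  have out: "(sysC (diagonal_system b l) *v y) $ 1 = (\<Sum>i\<in>UNIV. b i * y $ i)" for y
    by (simp add: diagonal_system_def matrix_vector_mult_def)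
  have "\<exists>z. \<forall>i. z i 0 = 0 \<and>
      (\<forall>t\<in>{0..1}. (z i has_vector_derivative l i * z i t + u t) (at t within {0..1}))"
    by (intro choice allI scalar_ode_solution_exists assms)
  then obtain z where z: "\<And>i. z i 0 = 0"
      "\<And>i t. t \<in> {0..1} \<Longrightarrow> (z i has_vector_derivative l i * z i t + u t) (at t within {0..1})"
    by blast
  have exists: "trajectory (diagonal_system b l) u (\<lambda>t. \<chi> i. z i t)"
    by (simp add: trajectory_diagonal_system_iff z)
  have unique: "x 1 $ i = exp_response u (l i)" if "trajectory (diagonal_system b l) u x" for x i
    using that by (intro scalar_ode_final_value) (auto simp: trajectory_diagonal_system_iff)
  have "z i 1 = exp_response u (l i)" for i
    using unique[OF exists] by simp
  then show ?thesis
    unfolding final_output_def out using exists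
    by (intro the_equality exI[of _ "\<lambda>t. \<chi> i. z i t"] conjI) (auto simp: unique)
qed

section \<open>Injectivity of the exponential response\<close>

text \<open>
  Only the values at the natural numbers are needed: they are, up to nonzero factors, the moments of
  \<open>u\<close> in the variable \<open>exp (- s)\<close>. Approximating \<open>u\<close> uniformly by polynomials in this variable
  shows that the integral of \<open>u\<^sup>2\<close> is zero.
\<close>

lemma exp_response_injective:
  fixes u :: "real \<Rightarrow> real"
  assumes cont: "continuous_on {0..1} u" and zero: "\<And>\<mu>. exp_response u \<mu> = 0"
    and t: "t \<in> {0..1}"
  shows "u t = 0"
proof -
  have moment: "integral {0..1} (\<lambda>s. exp (- s) ^ i * u s) = 0" for i :: nat
  proof -
    have "exp (real i * (1 - s)) = exp (real i) * exp (- s) ^ i" for s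
      by (simp add: right_diff_distrib exp_diff exp_minus exp_of_nat_mult power_inverse divide_inverse)
    then have "exp_response u (real i) = exp (real i) * integral {0..1} (\<lambda>s. exp (- s) ^ i * u s)"
      by (simp add: exp_response_def mult.assoc)
    then show ?thesis
      using zero by simp
  qed
  obtain M where M: "\<And>s. s \<in> {0..1} \<Longrightarrow> \<bar>u s\<bar> \<le> M"
    using compact_imp_bounded[OF compact_continuous_image[OF cont compact_Icc]]
    unfolding bounded_real by blast
  have approx: "integral {0..1} (\<lambda>s. u s * u s) \<le> M * e" if e: "e > 0" for e
  proof -
    have "continuous_on {exp (-1)..1} (\<lambda>x. u (- ln x))"
    proof (rule continuous_on_compose2[OF cont])
      show "continuous_on {exp (-1)..1} (\<lambda>x::real. - ln x)"
        by (intro continuous_intros) (use exp_gt_zero[of "-1::real"] in \<open>auto simp del: exp_gt_zero\<close>)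
      show "(\<lambda>x. - ln x) ` {exp (-1)..1} \<subseteq> {0..1::real}"
      proof (rule image_subsetI)
        fix x :: real assume "x \<in> {exp (-1)..1}"
        then have "exp (-1) \<le> x" "x \<le> 1"
          by auto
        moreover have "x > 0" using \<open>exp (-1) \<le> x\<close> exp_gt_zero[of "-1::real"] by linarith
        ultimately show "- ln x \<in> {0..1}" using ln_ge_iff[of x "-1"] by auto
      qed
    qed
    \<comment> \<open>Substitute \<open>x = exp (- s)\<close>, which maps \<open>[0,1]\<close> onto \<open>[exp (-1), 1]\<close>.\<close>
    then obtain P where P: "real_polynomial_function P"
        "\<And>x. x \<in> {exp (-1)..1} \<Longrightarrow> \<bar>u (- ln x) - P x\<bar> < e"
      using Stone_Weierstrass_real_polynomial_function[of "{exp (-1)..1}" "\<lambda>x. u (- ln x)" e] e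
      by auto
    then obtain a d where Pa: "P = (\<lambda>x. \<Sum>i\<le>d. a i * x ^ i)"
      using real_polynomial_function_iff_sum by metis
    have close: "\<bar>u s - P (exp (- s))\<bar> \<le> e" if "s \<in> {0..1}" for s
      using P(2)[of "exp (- s)"] that by simp
    have contP: "continuous_on {0..1} (\<lambda>s. P (exp (- s)))"
      unfolding Pa by (intro continuous_intros)
    have "integral {0..1} (\<lambda>s. P (exp (- s)) * u s)
        = (\<Sum>i\<le>d. integral {0..1} (\<lambda>s. a i * (exp (- s) ^ i * u s)))"
      unfolding Pa sum_distrib_right mult.assoc
      by (rule integral_sum) (auto intro!: integrable_continuous_real continuous_intros cont)
    then have "integral {0..1} (\<lambda>s. P (exp (- s)) * u s) = 0"
      by (simp add: moment)
    moreover have "integral {0..1} (\<lambda>s. (u s - P (exp (- s))) * u s)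
        = integral {0..1} (\<lambda>s. u s * u s) - integral {0..1} (\<lambda>s. P (exp (- s)) * u s)"
      unfolding left_diff_distrib
      by (rule integral_diff) (intro integrable_continuous_real continuous_intros cont contP)+
    moreover have "integral {0..1} (\<lambda>s. (u s - P (exp (- s))) * u s) \<le> integral {0..1::real} (\<lambda>s. M * e)"
    proof (rule integral_le)
      fix s :: real assume s: "s \<in> {0..1}"
      have "(u s - P (exp (- s))) * u s \<le> \<bar>u s - P (exp (- s))\<bar> * \<bar>u s\<bar>"
        by (metis abs_ge_self abs_mult)
      also have "\<dots> \<le> e * M"
        using close[OF s] M[OF s] e by (intro mult_mono) auto
      finally show "(u s - P (exp (- s))) * u s \<le> M * e"
        by (simp add: mult.commute)
    qed (intro integrable_continuous_real continuous_intros cont contP)+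
    ultimately show ?thesis
      by simp
  qed
  have "integral {0..1} (\<lambda>s. u s * u s) \<le> e" if "e > 0" for e
  proof -
    \<comment> \<open>The denominator \<open>M + 1\<close> allows for \<open>M = 0\<close>.\<close>
    have "M \<ge> 0" using M[OF t] by linarith
    then have "M * (e / (M + 1)) \<le> e"
      using that by (simp add: field_simps)
    with approx[of "e / (M + 1)"] that \<open>M \<ge> 0\<close> show ?thesis
      by simp
  qed
  then have "integral {0..1} (\<lambda>s. u s * u s) \<le> 0"
    by (rule field_le_epsilon[of _ 0, simplified])
  moreover have "integral {0..1} (\<lambda>s. u s * u s) \<ge> 0"
    by (rule integral_nonneg) (auto intro!: integrable_continuous_real continuous_intros cont)
  ultimately have "integral {0..1} (\<lambda>s. u s * u s) = 0"
    by linarith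
  moreover have "continuous_on {0..1} (\<lambda>s. u s * u s)"
    by (intro continuous_intros cont)
  ultimately have "u t * u t = 0"
    using integral_eq_0_iff[of 0 1 "\<lambda>s. u s * u s"] t by simp
  then show ?thesis
    by simp
qed

section \<open>Interpolation by linearly independent functions\<close>

text \<open>
  Finitely many linearly independent functions admit as many points at which their linear
  combinations take arbitrary prescribed values. The points are indexed by the same set \<open>J\<close> as the
  functions.
\<close>

lemma interpolation_nodes:
  fixes f :: "'j \<Rightarrow> 'a \<Rightarrow> 'b::field"
  assumes "finite J"
    and "\<And>g. (\<And>x. (\<Sum>j\<in>J. g j * f j x) = 0) \<Longrightarrow> \<forall>j\<in>J. g j = 0"
  shows "\<exists>x. \<forall>v. \<exists>g. \<forall>i\<in>J. (\<Sum>j\<in>J. g j * f j (x i)) = v i"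
  using assms
proof (induction J)
  case empty
  then show ?case by simp
next
  case (insert a J)
  have extend: "(\<Sum>j\<in>insert a J. (g(a := c)) j * f j y) = c * f a y + (\<Sum>j\<in>J. g j * f j y)"
    for g c y
  proof -
    have "(\<Sum>j\<in>J. (g(a := c)) j * f j y) = (\<Sum>j\<in>J. g j * f j y)"
      using insert.hyps by (intro sum.cong) auto
    then show ?thesis using insert.hyps by simp
  qed
  have "\<forall>j\<in>J. g j = 0" if "\<And>x. (\<Sum>j\<in>J. g j * f j x) = 0" for g
    using insert.prems[of "g(a := 0)"] that insert.hyps unfolding extend by (auto split: if_splits)
  then obtain x where x: "\<And>v. \<exists>g. \<forall>i\<in>J. (\<Sum>j\<in>J. g j * f j (x i)) = v i"
    using insert.IH by auto
  obtain h where h: "\<And>i. i \<in> J \<Longrightarrow> (\<Sum>j\<in>J. h j * f j (x i)) = - f a (x i)"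
    using x[of "\<lambda>i. - f a (x i)"] by auto
  \<comment> \<open>The combination \<open>r\<close> vanishes at all previous nodes, but not identically.\<close>
  define r where "r y = f a y + (\<Sum>j\<in>J. h j * f j y)" for y
  obtain y where y: "r y \<noteq> 0"
    using insert.prems[of "h(a := 1)"] unfolding extend r_def by auto
  show ?case
  proof (intro exI[of _ "x(a := y)"] allI)
    fix v
    obtain g where g: "\<And>i. i \<in> J \<Longrightarrow> (\<Sum>j\<in>J. g j * f j (x i)) = v i"
      using x[of v] by auto
    define c where "c = (v a - (\<Sum>j\<in>J. g j * f j y)) / r y"
    have eval: "(\<Sum>j\<in>insert a J. ((\<lambda>j. g j + c * h j)(a := c)) j * f j z)
        = c * r z + (\<Sum>j\<in>J. g j * f j z)" for z
      unfolding extend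
      by (simp add: r_def algebra_simps sum.distrib sum_distrib_left)
    have "(\<Sum>j\<in>insert a J. ((\<lambda>j. g j + c * h j)(a := c)) j * f j ((x(a := y)) i)) = v i"
      if "i \<in> insert a J" for i
    proof (cases "i = a")
      case True
      then show ?thesis
        unfolding eval using y by (simp add: c_def)
    next
      case False
      then show ?thesis
        unfolding eval using that by (simp add: r_def h g)
    qed
    then show "\<exists>g. \<forall>i\<in>insert a J. (\<Sum>j\<in>insert a J. g j * f j ((x(a := y)) i)) = v i"
      by blast
  qed
qed

section \<open>Shattered families of controls\<close>

text \<open>
  The separation hypothesis forces \<open>u\<close> to be injective on \<open>K\<close>, as the sets \<open>{i}\<close> show.
\<close>

lemma VC_ge_card_index:
  assumes "finite K" and "u ` K \<subseteq> X"
    and "\<And>T. T \<subseteq> K \<Longrightarrow> \<exists>c\<in>\<C>. \<forall>i\<in>K. c (u i) = (if i \<in> T then 1 else 0)"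
  shows "VC X \<C> \<ge> enat (card K)"
proof -
  have inj: "inj_on u K"
  proof (rule inj_onI)
    fix i j assume ij: "i \<in> K" "j \<in> K" "u i = u j"
    obtain c :: "_ \<Rightarrow> nat" where c: "\<forall>l\<in>K. c (u l) = (if l \<in> {i} then 1 else 0)"
      using assms(3)[of "{i}"] ij(1) by blast
    have "c (u i) = 1" "c (u j) = (if j = i then 1 else 0)"
      using bspec[OF c ij(1)] bspec[OF c ij(2)] by simp_all
    then show "i = j"
      unfolding ij(3) by (metis zero_neq_one)
  qed
  have "shattered \<C> (u ` K)"
    unfolding shattered_def
  proof
    fix \<phi> assume \<phi>: "\<phi> \<in> u ` K \<rightarrow>\<^sub>E {0, 1::nat}"
    obtain c where c: "c \<in> \<C>" "\<And>i. i \<in> K \<Longrightarrow> c (u i) = (if \<phi> (u i) = 1 then 1 else 0)"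
      using assms(3)[of "{i \<in> K. \<phi> (u i) = 1}"] by auto
    have "restrict c (u ` K) = \<phi>"
    proof (rule extensionalityI)
      show "restrict c (u ` K) \<in> extensional (u ` K)" "\<phi> \<in> extensional (u ` K)"
        using \<phi> by (auto simp: PiE_def)
      fix w assume "w \<in> u ` K"
      then show "restrict c (u ` K) w = \<phi> w"
        using PiE_mem[OF \<phi>, of w] c(2) by auto
    qed
    with c(1) show "\<exists>c\<in>\<C>. restrict c (u ` K) = \<phi>"
      by blast
  qed
  then have "enat (card (u ` K)) \<in> {enat (card D) | D. D \<subseteq> X \<and> finite D \<and> shattered \<C> D}"
    using assms(1,2) by blast
  then show ?thesis
    unfolding VC_def by (simp add: card_image[OF inj] Sup_upper)
qed

text \<open>
  Each coordinate in \<open>I\<close> is responsible for one block of \<open>q\<close> controls. It needs a node for each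
  nonempty subset of its block, and none for the empty subset, because it can be switched off by
  setting its output weight to 0. Thus \<open>q = 1\<close> requires only one node per coordinate.
\<close>

lemma VC_sign_class_ge:
  fixes I :: "'n::finite set"
  assumes cont: "\<And>j. j \<in> {1..k} \<Longrightarrow> continuous_on {0..1} (\<omega> j)"
    and indep: "lin_indep_inputs k \<omega>"
    and card: "card I * (2 ^ q - 1) \<le> k"
  shows "VC (controls k \<omega>) (sign_class TYPE('n) k \<omega>) \<ge> enat (card I * q)"
proof -
  \<comment> \<open>The labels of the nodes, encoded in \<open>{1..k}\<close> by \<open>\<sigma>\<close>.\<close>
  define N where "N = I \<times> (Pow {..<q} - {{}})"
  have "card N = card I * (2 ^ q - 1)"
    by (simp add: N_def card_cartesian_product card_Diff_singleton card_Pow)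
  then obtain \<sigma> where \<sigma>: "\<sigma> ` N \<subseteq> {1..k}" "inj_on \<sigma> N"
    using card card_le_inj[of N "{1..k}"] by (auto simp: N_def)
  have "\<exists>\<mu>. \<forall>v. \<exists>g. \<forall>i\<in>{1..k}. (\<Sum>j=1..k. g j * exp_response (\<omega> j) (\<mu> i)) = v i"
  proof (rule interpolation_nodes)
    fix g assume "\<And>\<mu>. (\<Sum>j=1..k. g j * exp_response (\<omega> j) \<mu>) = 0"
    then have zero: "exp_response (\<lambda>t. \<Sum>j=1..k. g j * \<omega> j t) \<mu> = 0" for \<mu>
      using exp_response_sum[of "{1..k}" \<omega> g \<mu>] cont by simp
    have "continuous_on {0..1} (\<lambda>t. \<Sum>j=1..k. g j * \<omega> j t)"
      by (intro continuous_intros cont)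
    then have "(\<Sum>j=1..k. g j * \<omega> j t) = 0" if "t \<in> {0..1}" for t
      using zero that by (rule exp_response_injective)
    then show "\<forall>j\<in>{1..k}. g j = 0"
      using indep unfolding lin_indep_inputs_def by blast
  qed simp
  then obtain \<mu> where \<mu>:
    "\<And>v. \<exists>g. \<forall>i\<in>{1..k}. (\<Sum>j=1..k. g j * exp_response (\<omega> j) (\<mu> i)) = v i"
    by blast
  define ctrl where "ctrl g = (\<lambda>t\<in>{0..1}. \<Sum>j=1..k. g j * \<omega> j t)" for g
  have ctrl_in: "ctrl g \<in> controls k \<omega>" for g
    by (auto simp: controls_def ctrl_def)
  have ctrl_cont: "continuous_on {0..1} (ctrl g)" for g
  proof -
    have "continuous_on {0..1} (\<lambda>t. \<Sum>j=1..k. g j * \<omega> j t)"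
      by (intro continuous_intros cont)
    then show ?thesis
      by (rule continuous_on_eq) (simp add: ctrl_def)
  qed
  have ctrl_response: "exp_response (ctrl g) x = (\<Sum>j=1..k. g j * exp_response (\<omega> j) x)" for g x
  proof -
    have "exp_response (ctrl g) x = exp_response (\<lambda>t. \<Sum>j=1..k. g j * \<omega> j t) x"
      by (rule exp_response_cong) (simp add: ctrl_def)
    then show ?thesis
      using exp_response_sum[of "{1..k}" \<omega> g x] cont by simp
  qed
  have "\<exists>g. \<forall>j S. (j, S) \<in> N \<longrightarrow> exp_response (ctrl g) (\<mu> (\<sigma> (j, S)))
      = (if i = j \<and> p \<in> S then 1 else 0)" for i p
  proof -
    obtain g where g: "\<And>m. m \<in> {1..k} \<Longrightarrow> exp_response (ctrl g) (\<mu> m)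
        = (case inv_into N \<sigma> m of (j, S) \<Rightarrow> if i = j \<and> p \<in> S then 1 else 0)"
      using \<mu>[of "\<lambda>m. case inv_into N \<sigma> m of (j, S) \<Rightarrow> if i = j \<and> p \<in> S then 1 else 0"]
      unfolding ctrl_response by blast
    have "exp_response (ctrl g) (\<mu> (\<sigma> (j, S))) = (if i = j \<and> p \<in> S then 1 else 0)"
      if "(j, S) \<in> N" for j S
      using g[of "\<sigma> (j, S)"] \<sigma> that by (simp add: inv_into_f_f image_subset_iff)
    then show ?thesis
      by blast
  qed
  then obtain g where g: "\<And>i p j S. (j, S) \<in> N \<Longrightarrow>
      exp_response (ctrl (g i p)) (\<mu> (\<sigma> (j, S))) = (if i = j \<and> p \<in> S then 1 else 0)"
    by metis
  let ?u = "\<lambda>(i, p). ctrl (g i p)"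
  have "enat (card (I \<times> {..<q})) \<le> VC (controls k \<omega>) (sign_class TYPE('n) k \<omega>)"
  proof (rule VC_ge_card_index[where u = ?u])
    show "finite (I \<times> {..<q})" "?u ` (I \<times> {..<q}) \<subseteq> controls k \<omega>"
      by (auto simp: ctrl_in)
    fix T assume T: "T \<subseteq> I \<times> {..<q}"
    \<comment> \<open>If \<open>S i\<close> is empty, then \<open>\<sigma> (i, S i)\<close> is arbitrary; the weight \<open>b i = 0\<close> makes it irrelevant.\<close>
    define S where "S i = {p. (i, p) \<in> T}" for i
    define b :: "'n \<Rightarrow> real" where "b i = (if S i = {} then 0 else 1)" for i
    define \<Sigma> where "\<Sigma> = diagonal_system b (\<lambda>i. \<mu> (\<sigma> (i, S i)))"
    have N: "(i, S i) \<in> N" if "S i \<noteq> {}" for i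
      using T that by (auto simp: N_def S_def)
    have "final_output \<Sigma> (ctrl (g i p)) = (if (i, p) \<in> T then 1 else 0)" for i p
    proof -
      have "b j * exp_response (ctrl (g i p)) (\<mu> (\<sigma> (j, S j)))
          = (if j = i then if (i, p) \<in> T then 1 else 0 else 0)" for j
        using g[OF N] by (auto simp: b_def S_def)
      then show ?thesis
        unfolding \<Sigma>_def final_output_diagonal_system[OF ctrl_cont] by simp
    qed
    then have "\<forall>e\<in>I \<times> {..<q}. sign_concept k \<omega> \<Sigma> (?u e) = (if e \<in> T then 1 else 0)"
      by (auto simp: sign_concept_def ctrl_in sign01_def)
    then show "\<exists>c\<in>sign_class TYPE('n) k \<omega>. \<forall>e\<in>I \<times> {..<q}. c (?u e) = (if e \<in> T then 1 else 0)"
      unfolding sign_class_def by blast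
  qed
  then show ?thesis
    by (simp add: card_cartesian_product)
qed

theorem theorem3p2:
  fixes \<omega> :: "nat \<Rightarrow> real \<Rightarrow> real" and k n m' :: nat
  assumes "n = CARD('n::finite)" and "k \<ge> 1"
    and "\<And>j. j \<in> {1..k} \<Longrightarrow> continuous_on {0..1} (\<omega> j)"
    and "lin_indep_inputs k \<omega>"
    and "m' = min n k"
  shows "VC (controls k \<omega>) (sign_class TYPE('n) k \<omega>)
    \<ge> enat (nat (max (int m' * \<lfloor>log 2 (real_of_int \<lfloor>real k / real m'\<rfloor>)\<rfloor>) (int m')))"
proof -
  have "m' \<le> card (UNIV :: 'n set)"
    using assms(1,5) by simp
  then obtain I :: "'n set" where I: "card I = m'"
    by (meson obtain_subset_with_card_n)
  have bound: "VC (controls k \<omega>) (sign_class TYPE('n) k \<omega>) \<ge> enat (m' * q)"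
    if "m' * (2 ^ q - 1) \<le> k" for q
    using VC_sign_class_ge[of k \<omega> I q] assms(3,4) that I by blast
  have "m' \<ge> 1"
    using assms(1,2,5) by (simp add: Suc_le_eq)
  define r where "r = k div m'"
  have r: "\<lfloor>real k / real m'\<rfloor> = int r"
    by (simp add: r_def floor_divide_of_nat_eq)
  have "r \<ge> 1"
    using \<open>m' \<ge> 1\<close> assms(5) by (simp add: r_def div_greater_zero_iff Suc_le_eq)
  define q where "q = nat \<lfloor>log 2 (real r)\<rfloor>"
  have log: "\<lfloor>log 2 (real r)\<rfloor> = int q"
    using \<open>r \<ge> 1\<close> by (simp add: q_def)
  then have "real q \<le> log 2 (real r)"
    by linarith
  then have "2 ^ q \<le> r"
    using \<open>r \<ge> 1\<close> by (simp add: le_log_iff powr_realpow)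
  then have "2 ^ q - 1 \<le> r"
    by simp
  then have "m' * (2 ^ q - 1) \<le> m' * r"
    by (rule mult_le_mono2)
  also have "\<dots> \<le> k"
    by (simp add: r_def)
  finally have "VC (controls k \<omega>) (sign_class TYPE('n) k \<omega>) \<ge> enat (m' * q)"
    by (rule bound)
  moreover have "VC (controls k \<omega>) (sign_class TYPE('n) k \<omega>) \<ge> enat (m' * 1)"
    using assms(5) by (intro bound) simp
  moreover have "nat (max (int m' * int q) (int m')) = max (m' * q) (m' * 1)"
    by (simp add: nat_eq_iff of_nat_max)
  ultimately show ?thesis
    unfolding r of_int_of_nat_eq log by (simp add: max_def)
qed

end
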